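(* Given a connected $(P_3+P_1)$-free graph $G$ with $n$ vertices and $m$ edges, one can compute $\operatorname{diam}(G)$ and return a diametral path of $G$ in $O(n+m)$ time.
   Context: Graphs are finite, simple, undirected and unweighted. A graph is $H$-free if it does not contain $H$ as an induced subgraph; $P_3+P_1$ is the disjoint union of a path on three vertices and an isolated vertex. $\operatorname{diam}(G)=\max_{u,v}d(u,v)$; a diametral path is a shortest path between two vertices at distance $\operatorname{diam}(G)$. *)

theory Defs
  imports "Graph_Theory.Graph_Theory"
begin

section \<open>Graphs\<close>

text \<open>
  A finite simple undirected graph is a \<^locale>\<open>pair_graph\<close>: a finite, loop-free digraph whose
  arcs are pairs of vertices and form a symmetric relation. Each undirected edge thus
  gives rise to two arcs.
\<close>

definition n_edges :: "'a pair_pre_digraph \<Rightarrow> nat" where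
  "n_edges G = card {{u, v} | u v. (u, v) \<in> parcs G}"

definition P3_plus_P1 :: "nat pair_pre_digraph" where
  "P3_plus_P1 = \<lparr> pverts = {0, 1, 2, 3}, parcs = {(0, 1), (1, 0), (1, 2), (2, 1)} \<rparr>"

definition H_free :: "('a, 'b) pre_digraph \<Rightarrow> ('c, 'd) pre_digraph \<Rightarrow> bool" where
  "H_free H G \<longleftrightarrow> \<not> (\<exists>K. induced_subgraph K G \<and> digraph_iso H K)"

definition gdist :: "('a, 'b) pre_digraph \<Rightarrow> 'a \<Rightarrow> 'a \<Rightarrow> ereal" where
  "gdist G u v = wf_digraph.\<mu> G (\<lambda>_. 1) u v"

definition diam :: "('a, 'b) pre_digraph \<Rightarrow> ereal" where
  "diam G = Max {gdist G u v | u v. u \<in> verts G \<and> v \<in> verts G}"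

definition diametral_path :: "('a, 'b) pre_digraph \<Rightarrow> 'a list \<Rightarrow> bool" where
  "diametral_path G p \<longleftrightarrow> vpath p G
     \<and> ereal (real (vwalk_length p)) = gdist G (hd p) (last p)
     \<and> gdist G (hd p) (last p) = diam G"


section \<open>Word RAM\<close>

text \<open>
  The machine has registers, named by constants in the program, and a memory addressed
  indirectly through registers; both hold words, i.e. natural numbers below \<open>2 ^ w\<close> (which
  every instruction preserves).
  Every elementary instruction and every evaluation of a branching condition takes one
  time unit. Multiplication, division and bitwise operations are left out, so that
  an upper bound on the running time carries over to the richer instruction sets in use.
\<close>

type_synonym reg = nat

record state =
  regs :: "reg \<Rightarrow> nat"
  mem :: "nat \<Rightarrow> nat"

datatype instr =
    SET reg nat
  | COPY reg reg
  | ADD reg reg reg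
  | SUB reg reg reg
  | LOAD reg reg
  | STORE reg reg

datatype cond =
    LESS reg reg
  | EQUAL reg reg

datatype prog =
    INSTR instr
  | SEQ prog prog
  | IF cond prog prog
  | WHILE cond prog

definition set_reg :: "reg \<Rightarrow> nat \<Rightarrow> state \<Rightarrow> state" where
  "set_reg r x s = s\<lparr>regs := (regs s)(r := x)\<rparr>"

text \<open>
  Addition wraps around modulo \<open>2 ^ w\<close>; subtraction is truncated at 0.
\<close>

fun instr_step :: "nat \<Rightarrow> instr \<Rightarrow> state \<Rightarrow> state" where
  "instr_step w (SET r k) s = set_reg r (k mod 2 ^ w) s"
| "instr_step w (COPY r a) s = set_reg r (regs s a) s"
| "instr_step w (ADD r a b) s = set_reg r ((regs s a + regs s b) mod 2 ^ w) s"
| "instr_step w (SUB r a b) s = set_reg r (regs s a - regs s b) s"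
| "instr_step w (LOAD r a) s = set_reg r (mem s (regs s a)) s"
| "instr_step w (STORE a b) s = s\<lparr>mem := (mem s)(regs s a := regs s b)\<rparr>"

fun holds :: "cond \<Rightarrow> state \<Rightarrow> bool" where
  "holds (LESS a b) s \<longleftrightarrow> regs s a < regs s b"
| "holds (EQUAL a b) s \<longleftrightarrow> regs s a = regs s b"

text \<open>
  \<open>exec w p s t s'\<close>: on word length \<open>w\<close>, program \<open>p\<close> started in state \<open>s\<close> halts in state \<open>s'\<close>
  after exactly \<open>t\<close> time units.
\<close>

inductive exec :: "nat \<Rightarrow> prog \<Rightarrow> state \<Rightarrow> nat \<Rightarrow> state \<Rightarrow> bool" for w where
  exec_INSTR: "exec w (INSTR i) s 1 (instr_step w i s)"
| exec_SEQ: "exec w p s t s' \<Longrightarrow> exec w q s' t' s'' \<Longrightarrow> exec w (SEQ p q) s (t + t') s''"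
| exec_IF_true: "holds b s \<Longrightarrow> exec w p s t s' \<Longrightarrow> exec w (IF b p q) s (Suc t) s'"
| exec_IF_false: "\<not> holds b s \<Longrightarrow> exec w q s t s' \<Longrightarrow> exec w (IF b p q) s (Suc t) s'"
| exec_WHILE_true: "holds b s \<Longrightarrow> exec w p s t s' \<Longrightarrow> exec w (WHILE b p) s' t' s''
    \<Longrightarrow> exec w (WHILE b p) s (Suc (t + t')) s''"
| exec_WHILE_false: "\<not> holds b s \<Longrightarrow> exec w (WHILE b p) s 1 s"

lemma exec_deterministic:
  "exec w p s t s' \<Longrightarrow> exec w p s u s'' \<Longrightarrow> t = u \<and> s' = s''"
proof (induction arbitrary: u s'' rule: exec.induct)
  case exec_INSTR then show ?case by (auto elim: exec.cases)
next
  case exec_SEQ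
  from exec_SEQ.prems show ?case by cases (use exec_SEQ.IH in blast)
next
  case exec_IF_true
  from exec_IF_true.prems show ?case by cases (use exec_IF_true in blast)+
next
  case exec_IF_false
  from exec_IF_false.prems show ?case by cases (use exec_IF_false in blast)+
next
  case exec_WHILE_true
  from exec_WHILE_true.prems show ?case by cases (use exec_WHILE_true in blast)+
next
  case exec_WHILE_false
  from exec_WHILE_false.prems show ?case by cases (use exec_WHILE_false in blast)+
qed


section \<open>Input and output\<close>

text \<open>
  The input graph has vertices \<open>0, \<dots>, n - 1\<close> and is given by its adjacency lists, in
  arbitrary order, stored one after the other: cell 0 holds \<open>n\<close>, cells \<open>1, \<dots>, n + 1\<close> hold
  pointers such that the neighbours of vertex \<open>v\<close> occupy the cells from the address in
  cell \<open>v + 1\<close> up to, but excluding, the address in cell \<open>v + 2\<close>. All other cells, and all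
  registers, are initially 0.
\<close>

definition adjacency_lists :: "'a pair_pre_digraph \<Rightarrow> ('a \<Rightarrow> 'a list) \<Rightarrow> bool" where
  "adjacency_lists G adj \<longleftrightarrow>
     (\<forall>v \<in> pverts G. distinct (adj v) \<and> set (adj v) = {u. (v, u) \<in> parcs G})"

definition encode_graph :: "nat \<Rightarrow> (nat \<Rightarrow> nat list) \<Rightarrow> nat list" where
  "encode_graph n adj =
     n # map (\<lambda>v. n + 2 + (\<Sum>u<v. length (adj u))) [0..<n + 1] @ concat (map adj [0..<n])"

definition initial_state :: "nat list \<Rightarrow> state" where
  "initial_state xs = \<lparr> regs = (\<lambda>_. 0), mem = (\<lambda>a. if a < length xs then xs ! a else 0) \<rparr>"

text \<open>
  The output is a number, in register 0, and a list stored in consecutive cells, whose address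
  and length are in registers 1 and 2.
\<close>

definition output_number :: "state \<Rightarrow> nat" where
  "output_number s = regs s 0"

definition output_list :: "state \<Rightarrow> nat list" where
  "output_list s = map (mem s) [regs s 1..<regs s 1 + regs s 2]"

end

(*
  Let G be connected and (P3 + P1)-free. If d(u,v) >= 3, then N[u] has no neighbour of v, so it
  contains no induced P3, and a vertex outside N[u] and N[v] with a neighbour in one of them
  would complete an induced P3 inside the non-neighbourhood of u or v. Hence the vertices split
  into two disjoint cliques N[u] and N[v]. In particular diam(G) <= 3, and a vertex x of minimum
  degree, say in N[u], has N[x] = N[u], so that d(x,v) = 3. If diam(G) <= 2, then x attains the
  diameter because it is universal only in a complete graph. So the diameter is the eccentricity
  of any vertex of minimum degree. Since it is at most 3, three sweeps over the adjacency lists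
  compute all distances from x, and a path is traced back from a farthest vertex.
*)

theory Submission
  imports Defs
begin

section \<open>Distances in $(P_3 + P_1)$-free graphs\<close>

context pair_graph
begin

text \<open>Natural-number distances allow induction and linear arithmetic. Where no walk exists the
  \<open>LEAST\<close> is arbitrary, so it is known to be attained only under connectedness
  (\<open>relpow_hops\<close>).\<close>

definition hops :: "'a \<Rightarrow> 'a \<Rightarrow> nat" where
  "hops u v = (LEAST d. (u, v) \<in> parcs G ^^ d)"

lemma awalk_imp_relpow: "awalk u p v \<Longrightarrow> (u, v) \<in> parcs G ^^ length p"
proof (induction p arbitrary: u)
  case (Cons e p)
  then show ?case
    by (cases e) (auto simp: awalk_Cons_iff simp del: relpow.simps intro: relpow_Suc_I2)
qed (auto simp: awalk_Nil_iff)

lemma relpow_imp_awalk: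
  "(u, v) \<in> parcs G ^^ d \<Longrightarrow> u \<in> pverts G \<Longrightarrow> \<exists>p. awalk u p v \<and> length p = d"
proof (induction d arbitrary: u)
  case 0
  then have "awalk u [] v" by (auto simp: awalk_Nil_iff)
  then show ?case by auto
next
  case (Suc d)
  then obtain z where z: "(u, z) \<in> parcs G" "(z, v) \<in> parcs G ^^ d"
    by (meson relpow_Suc_D2)
  then obtain p where "awalk z p v" "length p = d"
    using Suc.IH wellformed' by blast
  with z have "awalk u ((u, z) # p) v" "length ((u, z) # p) = Suc d"
    by (auto simp: awalk_Cons_iff wellformed')
  then show ?case by blast
qed

lemma relpow_parcs_commute: "(u, v) \<in> parcs G ^^ d \<longleftrightarrow> (v, u) \<in> parcs G ^^ d"
proof -
  have "(v, u) \<in> parcs G ^^ d" if "(u, v) \<in> parcs G ^^ d" for u v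
    using that
  proof (induction d arbitrary: v)
    case (Suc d)
    then obtain z where "(z, u) \<in> parcs G ^^ d" "(v, z) \<in> parcs G"
      using arcs_symmetric by auto
    then show ?case by (rule relpow_Suc_I2[rotated])
  qed simp
  then show ?thesis by blast
qed

lemma hops_commute: "hops u v = hops v u"
  unfolding hops_def by (subst relpow_parcs_commute) (rule refl)

lemma hops_le: "(u, v) \<in> parcs G ^^ d \<Longrightarrow> hops u v \<le> d"
  unfolding hops_def by (rule Least_le)

lemma hops_self [simp]: "hops u u = 0"
  using hops_le[of u u 0] by simp

definition closed_neighbourhood :: "'a \<Rightarrow> 'a set" where
  "closed_neighbourhood u = insert u {v. (u, v) \<in> parcs G}"

lemma closed_neighbourhood_subset: "u \<in> pverts G \<Longrightarrow> closed_neighbourhood u \<subseteq> pverts G"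
  by (auto simp: closed_neighbourhood_def wellformed')

lemma closed_neighbourhood_commute: "u \<in> closed_neighbourhood v \<longleftrightarrow> v \<in> closed_neighbourhood u"
  by (auto simp: closed_neighbourhood_def intro: arcs_symmetric)

end

section \<open>Distances, diameter and diametral paths in connected graphs\<close>

locale connected_pair_graph = pair_graph +
  assumes connected: "Digraph_Component.connected (with_proj G)"
begin

lemma verts_nonempty: "pverts G \<noteq> {}"
  using connected
  by (simp add: Digraph_Component.connected_def strongly_connected_def mk_symmetric_def)

text \<open>Connectedness supplies some walk from \<open>u\<close> to \<open>v\<close>, so the
  \<open>LEAST\<close> in \<open>hops\<close> is attained.\<close>

lemma relpow_hops:
  assumes "u \<in> pverts G" "v \<in> pverts G"
  shows "(u, v) \<in> parcs G ^^ hops u v"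
proof -
  have "u \<rightarrow>\<^sup>*\<^bsub>with_proj G\<^esub> v"
    using symmetric_connected_imp_strongly_connected[OF pair_sym_arcs connected] assms
    by (simp add: strongly_connected_def)
  then obtain p where "awalk u p v"
    by (auto simp: reachable_awalk)
  then show ?thesis
    unfolding hops_def by (intro LeastI) (rule awalk_imp_relpow)
qed

lemma hops_eq_0: "u \<in> pverts G \<Longrightarrow> v \<in> pverts G \<Longrightarrow> hops u v = 0 \<longleftrightarrow> u = v"
  using relpow_hops[of u v] by (cases "hops u v = 0") auto

lemma hops_le_Suc:
  assumes "(u, w) \<in> parcs G" "v \<in> pverts G"
  shows "hops u v \<le> Suc (hops w v)"
  using assms wellformed' by (intro hops_le relpow_Suc_I2[OF _ relpow_hops]) auto

text \<open>The rest of a shortest walk bounds \<open>hops w v\<close> from above, and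
  \<open>hops_le_Suc\<close> bounds it from below.\<close>

lemma hops_Suc_obtain:
  assumes "u \<in> pverts G" "v \<in> pverts G" "hops u v = Suc d"
  obtains w where "(u, w) \<in> parcs G" "w \<in> pverts G" "hops w v = d"
proof -
  obtain w where w: "(u, w) \<in> parcs G" "(w, v) \<in> parcs G ^^ d"
    using relpow_hops[OF assms(1,2)] assms(3) by (metis relpow_Suc_D2)
  moreover have "hops u v \<le> Suc (hops w v)"
    using w assms by (intro hops_le_Suc) auto
  ultimately show thesis
    using that hops_le assms(3) wellformed' by (metis Suc_le_mono le_antisym)
qed

text \<open>With unit costs a walk costs its length, so the infimum over walks is attained by one
  with \<open>hops u v\<close> arcs.\<close>

lemma gdist_eq_hops:
  assumes "u \<in> pverts G" "v \<in> pverts G"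
  shows "gdist (with_proj G) u v = ereal (real (hops u v))"
proof -
  have cost: "awalk_cost (\<lambda>_. 1) p = real (length p)" for p
    by (simp add: awalk_cost_def sum_list_triv)
  obtain p where p: "awalk u p v" "length p = hops u v"
    using relpow_imp_awalk[OF relpow_hops] assms by blast
  have "\<mu> (\<lambda>_. 1) u v \<le> ereal (real (hops u v))"
    using min_cost_le_walk_cost[OF p(1), of "\<lambda>_. 1"] p(2) by (simp add: cost)
  moreover have "ereal (real (hops u v)) \<le> \<mu> (\<lambda>_. 1) u v"
    unfolding \<mu>_def by (rule INF_greatest) (auto simp: cost hops_le awalk_imp_relpow)
  ultimately show ?thesis
    by (simp add: gdist_def)
qed

lemma diam_eqI:
  assumes "a \<in> pverts G" "b \<in> pverts G"
    and "\<And>u v. u \<in> pverts G \<Longrightarrow> v \<in> pverts G \<Longrightarrow> hops u v \<le> hops a b"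
  shows "diam (with_proj G) = ereal (real (hops a b))"
proof -
  have "{gdist (with_proj G) u v | u v. u \<in> pverts G \<and> v \<in> pverts G}
      = (\<lambda>(u, v). ereal (real (hops u v))) ` (pverts G \<times> pverts G)"
    by (auto simp: gdist_eq_hops image_iff) (metis gdist_eq_hops)+
  then have "diam (with_proj G) = Max ((\<lambda>(u, v). ereal (real (hops u v))) ` (pverts G \<times> pverts G))"
    by (simp add: diam_def)
  also have "\<dots> = ereal (real (hops a b))"
    using assms pair_finite_verts by (intro Max_eqI) auto
  finally show ?thesis .
qed

text \<open>Each entry is one step closer to \<open>x\<close> than the one before. Hence the last
  entry, at distance 0, is \<open>x\<close> itself, and entries at different positions are
  distinct.\<close>

lemma diametral_pathI:
  assumes "length p = Suc (hops (hd p) x)" "x \<in> pverts G"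
    and "\<And>i. i < length p \<Longrightarrow> p ! i \<in> pverts G \<and> hops (p ! i) x + i = hops (hd p) x"
    and "\<And>i. Suc i < length p \<Longrightarrow> (p ! i, p ! Suc i) \<in> parcs G"
    and "diam (with_proj G) = ereal (real (hops (hd p) x))"
  shows "diametral_path (with_proj G) p"
proof -
  have ne: "p \<noteq> []" using assms(1) by auto
  have verts: "set p \<subseteq> pverts G"
    using assms(3) by (auto simp: in_set_conv_nth)
  have last: "last p = x"
    using ne assms(1) assms(3)[of "length p - 1"] assms(2) hops_eq_0[of "last p" x]
    by (simp add: last_conv_nth)
  have "distinct p"
    unfolding distinct_conv_nth by (metis assms(3) add_left_cancel)
  moreover have "set (vwalk_arcs p) \<subseteq> parcs G"
    using assms(4)
  proof (induction p rule: vwalk_arcs.induct)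
    case (3 a b p)
    from "3.prems"[of 0] have "(a, b) \<in> parcs G" by simp
    moreover have "set (vwalk_arcs (b # p)) \<subseteq> parcs G"
      using "3.prems"[of "Suc i" for i] by (intro "3.IH") simp
    ultimately show ?case by simp
  qed auto
  ultimately have "vpath p (with_proj G)"
    using ne verts by (auto simp: vpath_def vwalk_def)
  moreover have "hd p \<in> pverts G" using verts ne by auto
  ultimately show ?thesis
    using assms(1,2,5) by (simp add: diametral_path_def last gdist_eq_hops)
qed

end

text \<open>Otherwise the four vertices would induce the forbidden graph, with \<open>b\<close> in
  the middle of the path and \<open>d\<close> isolated.\<close>

lemma P3_plus_P1_freeD:
  assumes "pair_graph G" "H_free (with_proj P3_plus_P1) (with_proj G)"
    and "(a, b) \<in> parcs G" "(b, c) \<in> parcs G" "(a, c) \<notin> parcs G" "a \<noteq> c"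
    and "d \<in> pverts G" "d \<notin> {a, b, c}"
  shows "(d, a) \<in> parcs G \<or> (d, b) \<in> parcs G \<or> (d, c) \<in> parcs G"
proof (rule ccontr)
  assume no: "\<not> ?thesis"
  interpret pair_graph G by fact
  have sym: "(u, v) \<in> parcs G \<longleftrightarrow> (v, u) \<in> parcs G" for u v
    using arcs_symmetric by blast
  have irr: "(u, u) \<notin> parcs G" for u
    using no_loops' by blast
  let ?V = "{a, b, c, d}" and ?A = "{(a, b), (b, a), (b, c), (c, b)}"
  define K where "K = with_proj \<lparr> pverts = ?V, parcs = ?A \<rparr>"
  have V: "?V \<subseteq> pverts G"
    using assms(3,4,7) wellformed' by auto
  \<comment> \<open>No further arcs run between the four vertices: the non-arc
    \<open>(a, c)\<close>, the assumption \<open>no\<close>, symmetry and loop-freeness exclude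
    them.\<close>
  have A: "?A = {e \<in> parcs G. fst e \<in> ?V \<and> snd e \<in> ?V}"
    using assms(3-6) no sym irr by auto
  have "wf_digraph (with_proj G)" by unfold_locales
  moreover have "wf_digraph K"
    by (auto simp: K_def wf_digraph_def)
  ultimately have "induced_subgraph K (with_proj G)"
    unfolding induced_subgraph_def subgraph_def
    using V A by (auto simp: K_def compatible_def)
  moreover have "digraph_iso (with_proj P3_plus_P1) K"
  proof -
    \<comment> \<open>The default value \<open>d\<close> serves as the image of vertex 3.\<close>
    define g where "g = (\<lambda>_ :: nat. d)(0 := a, 1 := b, 2 := c)"
    define h where "h = \<lparr> iso_verts = g, iso_arcs = map_prod g g, iso_head = snd, iso_tail = fst \<rparr>"
    have neq: "a \<noteq> b" "b \<noteq> c" "a \<noteq> c" "d \<noteq> a" "d \<noteq> b" "d \<noteq> c"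
      using assms irr by auto
    have "pre_digraph.digraph_isomorphism (with_proj P3_plus_P1) h"
      unfolding pre_digraph.digraph_isomorphism_def
      using neq by (auto simp: h_def g_def P3_plus_P1_def wf_digraph_def inj_on_def)
    moreover have "K = app_iso h (with_proj P3_plus_P1)"
      by (auto simp: K_def app_iso_def h_def g_def P3_plus_P1_def with_proj_def)
    ultimately show ?thesis
      unfolding digraph_iso_def by blast
  qed
  ultimately show False
    using assms(2) by (auto simp: H_free_def)
qed

section \<open>Structure of connected P3+P1-free graphs\<close>

locale connected_P3_plus_P1_free_graph = connected_pair_graph +
  assumes P3_plus_P1_free: "H_free (with_proj P3_plus_P1) (with_proj G)"
begin

lemmas P3_co_neighbour = P3_plus_P1_freeD[OF pair_graph P3_plus_P1_free]

text \<open>On a shortest path to a vertex \<open>v\<close> at distance at least 4, the first three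
  vertices \<open>u\<close>, \<open>a\<close>, \<open>b\<close> induce a P3. All of them are at
  distance at least 2 from \<open>v\<close>, so \<open>v\<close> completes the forbidden
  subgraph.\<close>

lemma hops_le_3:
  assumes "u \<in> pverts G" "v \<in> pverts G"
  shows "hops u v \<le> 3"
proof (rule ccontr)
  assume "\<not> ?thesis"
  then obtain k where k: "hops u v = Suc (Suc (Suc (Suc k)))"
    by (metis Suc_le_D not_less_eq_eq numeral_3_eq_3)
  obtain a where a: "(u, a) \<in> parcs G" "a \<in> pverts G" "hops a v = Suc (Suc (Suc k))"
    using hops_Suc_obtain assms k by blast
  obtain b where b: "(a, b) \<in> parcs G" "b \<in> pverts G" "hops b v = Suc (Suc k)"
    using hops_Suc_obtain assms a by blast
  have far: "(v, z) \<notin> parcs G" if "hops z v > 1" for z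
    using that hops_le_Suc[of z v v] assms arcs_symmetric by fastforce
  have "(u, b) \<notin> parcs G"
    using hops_le_Suc[of u b v] assms k b by auto
  moreover have "u \<noteq> b" "v \<notin> {u, a, b}"
    using k a b by auto
  ultimately show False
    using P3_co_neighbour[OF a(1) b(1), of v] assms far[of u] far[of a] far[of b] k a b by simp
qed

lemma hops_le_1_iff:
  assumes "u \<in> pverts G" "v \<in> pverts G"
  shows "hops u v \<le> 1 \<longleftrightarrow> v \<in> closed_neighbourhood u"
proof
  assume "hops u v \<le> 1"
  then have "hops u v = 0 \<or> hops u v = 1" by linarith
  then show "v \<in> closed_neighbourhood u"
    using relpow_hops[OF assms] by (auto simp: closed_neighbourhood_def)
next
  assume "v \<in> closed_neighbourhood u"
  then show "hops u v \<le> 1"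
    using hops_le_Suc[of u v v] assms by (auto simp: closed_neighbourhood_def)
qed

text \<open>A common element of the two neighbourhoods gives a walk of length at most 2, and
  conversely. In this form a distance of 3 carries over to any vertex with the same closed
  neighbourhood.\<close>

lemma hops_ge_3_iff:
  assumes "u \<in> pverts G" "v \<in> pverts G"
  shows "3 \<le> hops u v \<longleftrightarrow> closed_neighbourhood u \<inter> closed_neighbourhood v = {}"
proof
  assume far: "3 \<le> hops u v"
  have "hops u v \<le> 2" if "z \<in> closed_neighbourhood u" "z \<in> closed_neighbourhood v" for z
  proof -
    have z: "z \<in> pverts G" using that assms closed_neighbourhood_subset by blast
    then have "hops z v \<le> 1"
      using that assms hops_le_1_iff[of v z] hops_commute[of z v] by simp
    then show ?thesis
      using that assms z hops_le_Suc[of u z v] by (auto simp: closed_neighbourhood_def)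
  qed
  with far show "closed_neighbourhood u \<inter> closed_neighbourhood v = {}" by fastforce
next
  assume disj: "closed_neighbourhood u \<inter> closed_neighbourhood v = {}"
  show "3 \<le> hops u v"
  proof (rule ccontr)
    assume "\<not> 3 \<le> hops u v"
    then consider "hops u v \<le> 1" | "hops u v = Suc 1" by linarith
    then show False
    proof cases
      case 1
      then show False
        using disj assms hops_le_1_iff by (auto simp: closed_neighbourhood_def)
    next
      case 2
      then obtain z where "(u, z) \<in> parcs G" "z \<in> pverts G" "hops z v = 1"
        using hops_Suc_obtain assms by blast
      then show False
        using disj assms hops_le_1_iff[of z v] closed_neighbourhood_commute[of z v]
        by (auto simp: closed_neighbourhood_def)
    qed
  qed
qed

text \<open>
  A missing edge inside the closed neighbourhood of \<open>u\<close> would give an induced path on three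
  vertices far away from \<open>v\<close>.
\<close>

lemma closed_neighbourhood_clique:
  assumes "u \<in> pverts G" "v \<in> pverts G" "3 \<le> hops u v"
    and "a \<in> closed_neighbourhood u"
  shows "closed_neighbourhood u \<subseteq> closed_neighbourhood a"
proof
  fix b assume b: "b \<in> closed_neighbourhood u"
  show "b \<in> closed_neighbourhood a"
  proof (rule ccontr)
    assume n: "b \<notin> closed_neighbourhood a"
    then have P3: "(a, u) \<in> parcs G" "(u, b) \<in> parcs G" "(a, b) \<notin> parcs G" "a \<noteq> b"
      using assms(4) b arcs_symmetric[of u a] by (auto simp: closed_neighbourhood_def)
    have "z \<notin> closed_neighbourhood v" if "z \<in> closed_neighbourhood u" for z
      using that hops_ge_3_iff[OF assms(1,2)] assms(3) by blast
    then have "(v, z) \<notin> parcs G \<and> v \<noteq> z" if "z \<in> closed_neighbourhood u" for z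
      using that unfolding closed_neighbourhood_def by blast
    from this[OF assms(4)] this[OF b] this[of u] show False
      using P3_co_neighbour[OF P3, of v] assms(2) by (simp add: closed_neighbourhood_def)
  qed
qed

text \<open>The union of the two neighbourhoods is closed under adjacency, and every vertex is
  reachable from \<open>u\<close>.\<close>

lemma hops_3_cover:
  assumes "u \<in> pverts G" "v \<in> pverts G" "3 \<le> hops u v"
  shows "pverts G = closed_neighbourhood u \<union> closed_neighbourhood v"
proof -
  let ?C = "closed_neighbourhood u \<union> closed_neighbourhood v"
  \<comment> \<open>If an arc from \<open>a\<close> left the union at \<open>w\<close>, then
    \<open>p\<close>, \<open>a\<close>, \<open>w\<close> would induce a P3 without neighbours of
    \<open>q\<close>. Stating this for \<open>p\<close> and \<open>q\<close> allows both assignments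
    of the two centres.\<close>
  have step: "w \<in> closed_neighbourhood p \<union> closed_neighbourhood q"
    if "(a, w) \<in> parcs G" "a \<in> closed_neighbourhood p"
      "closed_neighbourhood p \<inter> closed_neighbourhood q = {}" "q \<in> pverts G" for p q a w
  proof (rule ccontr)
    assume w: "w \<notin> closed_neighbourhood p \<union> closed_neighbourhood q"
    then have P3: "(p, a) \<in> parcs G" "(p, w) \<notin> parcs G" "p \<noteq> w"
      using that unfolding closed_neighbourhood_def by blast+
    have "(q, z) \<notin> parcs G \<and> q \<noteq> z" if "z \<in> {p, a, w}" for z
      using that w \<open>a \<in> closed_neighbourhood p\<close>
        \<open>closed_neighbourhood p \<inter> closed_neighbourhood q = {}\<close>
      unfolding closed_neighbourhood_def by blast
    then show False
      using P3_co_neighbour[OF P3(1) that(1) P3(2,3) that(4)] by blast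
  qed
  have closed: "w \<in> ?C" if "a \<in> ?C" "(a, w) \<in> parcs G" for a w
    using that step[of a w u v] step[of a w v u] assms hops_ge_3_iff by blast
  have "w \<in> ?C" if "(u, w) \<in> parcs G ^^ d" for d w
    using that
  proof (induction d arbitrary: w)
    case (Suc d)
    then show ?case using closed by auto
  qed (simp add: closed_neighbourhood_def)
  then show ?thesis
    using relpow_hops assms closed_neighbourhood_subset by blast
qed

text \<open>The clique property gives one inclusion between the neighbourhoods of \<open>u\<close>
  and \<open>x\<close>, and the cardinality bound makes them equal. Disjointness from the
  neighbourhood of \<open>v\<close> then passes from \<open>u\<close> to \<open>x\<close>.\<close>

lemma hops_3_from_min_degree:
  assumes "u \<in> pverts G" "v \<in> pverts G" "3 \<le> hops u v" "x \<in> closed_neighbourhood u"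
    and "card (closed_neighbourhood x) \<le> card (closed_neighbourhood u)"
  shows "3 \<le> hops v x"
proof -
  have x: "x \<in> pverts G" using assms closed_neighbourhood_subset by blast
  then have "finite (closed_neighbourhood x)"
    using closed_neighbourhood_subset finite_subset pair_finite_verts by blast
  then have "closed_neighbourhood u = closed_neighbourhood x"
    using assms closed_neighbourhood_clique by (intro card_subset_eq) (auto simp: le_antisym card_mono)
  then show ?thesis
    using assms x hops_ge_3_iff hops_commute by metis
qed

lemma diam_eq_eccentricity_of_min_degree:
  assumes x: "x \<in> pverts G"
    and min: "\<And>u. u \<in> pverts G \<Longrightarrow> card (closed_neighbourhood x) \<le> card (closed_neighbourhood u)"
    and y: "y \<in> pverts G" "\<And>u. u \<in> pverts G \<Longrightarrow> hops u x \<le> hops y x"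
  shows "diam (with_proj G) = ereal (real (hops y x))"
proof (rule diam_eqI[OF y(1) x])
  fix u v assume uv: "u \<in> pverts G" "v \<in> pverts G"
  have "hops u v \<le> 3" using uv by (rule hops_le_3)
  then consider "hops u v = 0" | "hops u v = 1" | "hops u v = 2" | "hops u v = 3" by linarith
  then show "hops u v \<le> hops y x"
  proof cases
    case 2
    \<comment> \<open>At distance 1 the graph has a vertex other than \<open>x\<close>.\<close>
    then have "u \<noteq> x \<or> v \<noteq> x" by auto
    then obtain z where z: "z \<in> pverts G" "z \<noteq> x" using uv by blast
    then have "hops z x \<noteq> 0" using x hops_eq_0 by blast
    then show ?thesis using 2 y(2)[OF z(1)] by simp
  next
    case 3
    \<comment> \<open>Since \<open>u\<close> misses \<open>v\<close>, its neighbourhood is not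
      everything. By minimality neither is that of \<open>x\<close>, so some vertex is at distance
      at least 2 from \<open>x\<close>.\<close>
    then have "closed_neighbourhood u \<subset> pverts G"
      using uv hops_le_1_iff[of u v] closed_neighbourhood_subset by auto
    then have "card (closed_neighbourhood x) < card (pverts G)"
      using min[OF uv(1)] psubset_card_mono[OF pair_finite_verts] le_less_trans by blast
    then have "\<not> pverts G \<subseteq> closed_neighbourhood x"
      using closed_neighbourhood_subset[OF x] by auto
    then obtain z where z: "z \<in> pverts G" "z \<notin> closed_neighbourhood x"
      by blast
    then show ?thesis
      using 3 x y(2)[OF z(1)] hops_le_1_iff[of x z] hops_commute[of x z] by simp
  next
    case 4
    \<comment> \<open>Whichever of the two cliques contains \<open>x\<close>, the centre of the
      other one is at distance 3 from it.\<close>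
    have "x \<in> closed_neighbourhood u \<or> x \<in> closed_neighbourhood v"
      using hops_3_cover[of u v] uv x 4 by auto
    then have "3 \<le> hops v x \<or> 3 \<le> hops u x"
      using hops_3_from_min_degree[of u v x] hops_3_from_min_degree[of v u x]
        hops_commute[of u v] 4 uv min by auto
    then show ?thesis using y(2) uv 4 by fastforce
  qed simp
qed

end

section \<open>Running time assertions\<close>

text \<open>The postcondition also receives the time, so simplification with the equivalences below
  computes cost and final state of straight-line code together.\<close>

definition runs :: "nat \<Rightarrow> prog \<Rightarrow> state \<Rightarrow> (nat \<Rightarrow> state \<Rightarrow> bool) \<Rightarrow> bool" where
  "runs w p s Q \<longleftrightarrow> (\<exists>t s'. exec w p s t s' \<and> Q t s')"

lemma runs_INSTR [simp]: "runs w (INSTR i) s Q \<longleftrightarrow> Q 1 (instr_step w i s)"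
  unfolding runs_def by (metis exec_INSTR exec_deterministic)

lemma runs_SEQ [simp]:
  "runs w (SEQ p q) s Q \<longleftrightarrow> runs w p s (\<lambda>t s'. runs w q s' (\<lambda>t' s''. Q (t + t') s''))"
  unfolding runs_def by (auto elim: exec.cases intro: exec_SEQ) (erule exec.cases; auto)

lemma runs_IF [simp]:
  "runs w (IF b p q) s Q \<longleftrightarrow>
     (if holds b s then runs w p s (\<lambda>t. Q (Suc t)) else runs w q s (\<lambda>t. Q (Suc t)))"
  unfolding runs_def
  by (auto intro: exec_IF_true exec_IF_false; erule exec.cases; auto)

lemma runs_mono: "runs w p s Q \<Longrightarrow> (\<And>t s'. Q t s' \<Longrightarrow> Q' t s') \<Longrightarrow> runs w p s Q'"
  unfolding runs_def by blast

text \<open>The number \<open>k\<close> of iterations is fixed in advance. Each one costs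
  \<open>c i\<close> plus a unit for the successful test, and the failing test costs the final
  1.\<close>

lemma runs_WHILE:
  assumes step: "\<And>i s. i < k \<Longrightarrow> I i s \<Longrightarrow> holds b s \<and> runs w p s (\<lambda>t s'. t \<le> c i \<and> I (Suc i) s')"
    and stop: "\<And>s. I k s \<Longrightarrow> \<not> holds b s"
    and init: "I 0 s"
  shows "runs w (WHILE b p) s (\<lambda>t s'. t \<le> (\<Sum>i<k. Suc (c i)) + 1 \<and> I k s')"
proof -
  \<comment> \<open>Generalised to a start in iteration \<open>j\<close>, for induction on the
    remaining \<open>k - j\<close> rounds.\<close>
  have "runs w (WHILE b p) s (\<lambda>t s'. t \<le> (\<Sum>i\<in>{j..<k}. Suc (c i)) + 1 \<and> I k s')"
    if "j \<le> k" "I j s" for j s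
    using that
  proof (induction "k - j" arbitrary: j s)
    case 0
    then show ?case
      using stop exec_WHILE_false by (fastforce simp: runs_def)
  next
    case (Suc d)
    then have j: "j < k" by simp
    then obtain t s' where s': "exec w p s t s'" "t \<le> c j" "I (Suc j) s'" "holds b s"
      using step Suc.prems unfolding runs_def by blast
    have "runs w (WHILE b p) s' (\<lambda>t s'. t \<le> (\<Sum>i\<in>{Suc j..<k}. Suc (c i)) + 1 \<and> I k s')"
      using Suc j s' by (intro Suc.hyps) auto
    then obtain t' s'' where "exec w (WHILE b p) s' t' s''"
        "t' \<le> (\<Sum>i\<in>{Suc j..<k}. Suc (c i)) + 1" "I k s''"
      unfolding runs_def by blast
    then show ?case
      using s' exec_WHILE_true[OF s'(4,1)] j unfolding runs_def
      by (intro exI[of _ "Suc (t + t')"] exI[of _ s'']) (simp add: sum.atLeast_Suc_lessThan)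
  qed
  from this[of 0 s] init show ?thesis
    by (simp add: atLeast0LessThan)
qed

lemma regs_set_reg [simp]: "regs (set_reg r x s) = (regs s)(r := x)"
  by (simp add: set_reg_def)

lemma mem_set_reg [simp]: "mem (set_reg r x s) = mem s"
  by (simp add: set_reg_def)

lemma set_reg_id [simp]: "set_reg r (regs s r) s = s"
  by (simp add: set_reg_def)

section \<open>The program\<close>

notation SEQ (infixr ";;" 60)

text \<open>
  Register \<open>rX\<close> holds the vertex of minimum degree and \<open>rFar\<close> a vertex farthest from it.
  The cell at address \<open>rBase + v\<close> holds 0 as long as vertex \<open>v\<close> has not been reached, and one more
  than its distance from \<open>rX\<close> afterwards; the path is stored from address \<open>rBase + rN\<close> on.
  Until then \<open>rOut\<close> is still 0, so the first load reads \<open>n\<close> from cell 0.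
\<close>

abbreviation (input) "rOut \<equiv> 0 :: reg"
abbreviation (input) "rAddr \<equiv> 1 :: reg"
abbreviation (input) "rLen \<equiv> 2 :: reg"
abbreviation (input) "rOne \<equiv> 3 :: reg"
abbreviation (input) "rN \<equiv> 4 :: reg"
abbreviation (input) "rBase \<equiv> 5 :: reg"
abbreviation (input) "rX \<equiv> 6 :: reg"
abbreviation (input) "rMin \<equiv> 7 :: reg"
abbreviation (input) "rCur \<equiv> 8 :: reg"
abbreviation (input) "rLev \<equiv> 9 :: reg"
abbreviation (input) "rFour \<equiv> 10 :: reg"
abbreviation (input) "rFar \<equiv> 11 :: reg"
abbreviation (input) "rPtr \<equiv> 12 :: reg"
abbreviation (input) "rLo \<equiv> 13 :: reg"
abbreviation (input) "rHi \<equiv> 14 :: reg"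
abbreviation (input) "rNbr \<equiv> 15 :: reg"
abbreviation (input) "rFound \<equiv> 16 :: reg"
abbreviation (input) "rTmp \<equiv> 17 :: reg"

text \<open>The registers that \<open>scan\<close> may overwrite; callers rely on all others being
  preserved.\<close>

abbreviation (input) "scratch \<equiv> {rPtr, rLo, rHi, rNbr, rFound, rTmp}"

text \<open>A no-op of cost one for empty else branches.\<close>

definition skip :: prog where
  "skip = INSTR (COPY rOut rOut)"

lemma runs_skip [simp]: "runs w skip s Q \<longleftrightarrow> Q 1 s"
  by (simp add: skip_def)

text \<open>Cell \<open>n + 1\<close> points past the last adjacency list, hence to the first free
  cell, which becomes \<open>rBase\<close>.\<close>

definition load_header :: prog where
  "load_header = INSTR (SET rOne 1);; INSTR (LOAD rN rOut);;
     INSTR (ADD rPtr rN rOne);; INSTR (LOAD rBase rPtr)"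

definition load_bounds :: prog where
  "load_bounds = INSTR (ADD rPtr rCur rOne);; INSTR (LOAD rLo rPtr);;
     INSTR (ADD rPtr rPtr rOne);; INSTR (LOAD rHi rPtr)"

definition for_vertices :: "prog \<Rightarrow> prog" where
  "for_vertices p = INSTR (SET rCur 0);; WHILE (LESS rCur rN) (p;; INSTR (ADD rCur rCur rOne))"

text \<open>The initial value \<open>n\<close> exceeds every degree, so the first vertex always
  replaces it.\<close>

definition find_min_degree :: prog where
  "find_min_degree = INSTR (COPY rMin rN);;
     for_vertices (load_bounds;; INSTR (SUB rTmp rHi rLo);;
       IF (LESS rTmp rMin) (INSTR (COPY rX rCur);; INSTR (COPY rMin rTmp)) skip)"

text \<open>Searches the neighbours of \<open>rCur\<close> for one labelled \<open>rLev\<close>. The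
  flag drives the sweeps and the neighbour found drives the path extraction.\<close>

definition scan :: prog where
  "scan = INSTR (SET rFound 0);; load_bounds;;
     WHILE (LESS rLo rHi)
       (INSTR (LOAD rPtr rLo);; INSTR (ADD rTmp rBase rPtr);; INSTR (LOAD rTmp rTmp);;
        IF (EQUAL rTmp rLev) (INSTR (COPY rNbr rPtr);; INSTR (SET rFound 1)) skip;;
        INSTR (ADD rLo rLo rOne))"

text \<open>Adds one breadth-first layer: unreached vertices next to a label \<open>rLev\<close>
  receive \<open>rLev + 1\<close>.\<close>

definition sweep :: prog where
  "sweep = for_vertices (INSTR (ADD rPtr rBase rCur);; INSTR (LOAD rTmp rPtr);;
     IF (LESS rTmp rOne)
       (scan;; IF (EQUAL rFound rOne)
          (INSTR (ADD rPtr rBase rCur);; INSTR (ADD rTmp rLev rOne);; INSTR (STORE rPtr rTmp)) skip)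
       skip)"

text \<open>Labels are distances plus one and distances are at most 3, so sweeps for
  \<open>rLev\<close> = 1, 2, 3 reach everything.\<close>

definition compute_levels :: prog where
  "compute_levels = INSTR (ADD rPtr rBase rX);; INSTR (STORE rPtr rOne);;
     INSTR (SET rFour 4);; INSTR (SET rLev 1);;
     WHILE (LESS rLev rFour) (sweep;; INSTR (ADD rLev rLev rOne))"

text \<open>Labels are positive by now, so the start value 0 is beaten at once. The final
  \<open>rLev\<close> is the label of \<open>rFar\<close>, from which \<open>extract_path\<close>
  counts down.\<close>

definition find_farthest :: prog where
  "find_farthest = INSTR (SET rLev 0);;
     for_vertices (INSTR (ADD rPtr rBase rCur);; INSTR (LOAD rTmp rPtr);;
       IF (LESS rLev rTmp) (INSTR (COPY rFar rCur);; INSTR (COPY rLev rTmp)) skip)"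

text \<open>Each round lowers the wanted label by one and moves to a neighbour carrying it; label 1
  belongs to \<open>rX\<close> alone.\<close>

definition extract_path :: prog where
  "extract_path = INSTR (SUB rOut rLev rOne);; INSTR (ADD rAddr rBase rN);; INSTR (SET rLen 1);;
     INSTR (COPY rCur rFar);; INSTR (STORE rAddr rCur);;
     WHILE (LESS rOne rLev)
       (INSTR (SUB rLev rLev rOne);; scan;; INSTR (COPY rCur rNbr);;
        INSTR (ADD rPtr rAddr rLen);; INSTR (STORE rPtr rCur);; INSTR (ADD rLen rLen rOne))"

definition diameter_prog :: prog where
  "diameter_prog = load_header;; find_min_degree;; compute_levels;; find_farthest;; extract_path"

section \<open>Correctness of the program\<close>

text \<open>The sum counts the entries stored before the block of \<open>v\<close>.\<close>

lemma nth_concat_map_upt: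
  assumes "v < n" "j < length (f v)"
  shows "concat (map f [0..<n]) ! ((\<Sum>u<v. length (f u)) + j) = f v ! j"
proof -
  have "[0..<n] = [0..<v] @ v # [Suc v..<n]"
    using assms(1) upt_add_eq_append[of 0 v "n - v"] by (simp add: upt_conv_Cons)
  moreover have "length (concat (map f [0..<v])) = (\<Sum>u<v. length (f u))"
    by (simp add: length_concat comp_def interv_sum_list_conv_sum_set_nat atLeast0LessThan)
  ultimately show ?thesis
    using assms(2) by (simp add: nth_append)
qed

section \<open>Input layout, degrees and word length\<close>

locale ram_input = connected_P3_plus_P1_free_graph G for G :: "nat pair_pre_digraph" +
  fixes n :: nat and adj :: "nat \<Rightarrow> nat list" and w :: nat
  assumes verts: "pverts G = {..<n}"
    and adj: "adjacency_lists G adj"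
    and word_length: "20 * (n + n_edges G) \<le> 2 ^ w"
begin

abbreviation deg :: "nat \<Rightarrow> nat" where
  "deg v \<equiv> length (adj v)"

text \<open>The address where the list of \<open>v\<close> starts; for \<open>v = n\<close> it is
  the first cell after the input.\<close>

definition offset :: "nat \<Rightarrow> nat" where
  "offset v = n + 2 + (\<Sum>u<v. deg u)"

abbreviation base :: nat where
  "base \<equiv> offset n"

abbreviation input_mem :: "nat \<Rightarrow> nat" where
  "input_mem \<equiv> mem (initial_state (encode_graph n adj))"

lemma n_pos: "0 < n"
  using verts_nonempty verts by auto

lemma set_adj: "v < n \<Longrightarrow> set (adj v) = {u. (v, u) \<in> parcs G}"
  using adj verts by (auto simp: adjacency_lists_def)

lemma adj_less: "v < n \<Longrightarrow> u \<in> set (adj v) \<Longrightarrow> u < n"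
  using set_adj wellformed'(2) verts by auto

lemma adj_nth_less: "v < n \<Longrightarrow> j < deg v \<Longrightarrow> adj v ! j < n"
  using adj_less by simp

lemma deg_eq_card: "v < n \<Longrightarrow> deg v = card {u. (v, u) \<in> parcs G}"
  using adj verts set_adj by (metis adjacency_lists_def distinct_card lessThan_iff)

lemma card_closed_neighbourhood: 
  assumes "v < n"
  shows "card (closed_neighbourhood v) = Suc (deg v)"
proof -
  have "finite {u. (v, u) \<in> parcs G}" using set_adj[OF assms] by (metis List.finite_set)
  moreover have "(v, v) \<notin> parcs G" using no_loops' by blast
  ultimately show ?thesis
    using assms by (simp add: closed_neighbourhood_def deg_eq_card)
qed

lemma deg_less: 
  assumes "v < n"
  shows "deg v < n"
proof -
  have "card (closed_neighbourhood v) \<le> n"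
    using card_mono[of "{..<n}" "closed_neighbourhood v"] closed_neighbourhood_subset[of v] verts assms
    by auto
  then show ?thesis using card_closed_neighbourhood assms by simp
qed

text \<open>The arcs are split into fibres over their underlying edges, each with at most two
  elements.\<close>

lemma card_parcs_le: "card (parcs G) \<le> 2 * n_edges G"
proof -
  define E where "E = {{u, v} | u v. (u, v) \<in> parcs G}"
  have E: "E = (\<lambda>(u, v). {u, v}) ` parcs G"
    by (auto simp: E_def)
  have "parcs G \<subseteq> (\<Union>e\<in>E. {a. {fst a, snd a} = e})"
    by (force simp: E)
  moreover have fin: "finite {a. {fst a, snd a} = e} \<and> card {a. {fst a, snd a} = e} \<le> 2"
    if e: "e \<in> E" for e
  proof -
    obtain u v where "e = {u, v}" using e unfolding E_def by blast
    then have "{fst a, snd a} = e \<longleftrightarrow> a = (u, v) \<or> a = (v, u)" for a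
      by (cases a) (simp add: doubleton_eq_iff)
    then have eq: "{a. {fst a, snd a} = e} = {(u, v), (v, u)}"
      by blast
    show ?thesis unfolding eq by (cases "u = v") simp_all
  qed
  moreover have "finite E" by (simp add: E pair_finite_arcs)
  ultimately have "card (parcs G) \<le> card (\<Union>e\<in>E. {a. {fst a, snd a} = e})"
    by (intro card_mono finite_UN_I) auto
  also have "\<dots> \<le> (\<Sum>e\<in>E. card {a. {fst a, snd a} = e})"
    using \<open>finite E\<close> by (rule card_UN_le)
  also have "\<dots> \<le> (\<Sum>e\<in>E. 2)"
    using fin by (intro sum_mono) blast
  also have "\<dots> = 2 * n_edges G"
    unfolding n_edges_def E_def[symmetric] by simp
  finally show ?thesis .
qed

text \<open>The arc set is the disjoint union of the out-neighbourhoods, so the degree sum counts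
  arcs.\<close>

lemma sum_deg_le: "(\<Sum>u<n. deg u) \<le> 2 * n_edges G"
proof -
  have "finite {v. (u, v) \<in> parcs G}" if "u < n" for u
    using set_adj[OF that] by (metis List.finite_set)
  then have "(\<Sum>u<n. deg u) = card (SIGMA u:{..<n}. {v. (u, v) \<in> parcs G})"
    by (subst card_SigmaI) (auto simp: deg_eq_card)
  moreover have "(SIGMA u:{..<n}. {v. (u, v) \<in> parcs G}) = parcs G"
    using verts wellformed' by auto
  ultimately show ?thesis using card_parcs_le by simp
qed

lemma offset_Suc: "offset (Suc v) = offset v + deg v"
  by (simp add: offset_def)

lemma offset_mono: "u \<le> v \<Longrightarrow> offset u \<le> offset v"
  by (auto simp: offset_def intro: sum_mono2)

lemma offset_add_le_base: "v < n \<Longrightarrow> offset v + deg v \<le> base"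
  using offset_mono[of "Suc v" n] by (simp add: offset_Suc)

lemma n_less_base: "n + 1 < base"
  by (simp add: offset_def)

text \<open>The left side is at most \<open>2 * (n + n_edges G) + 7\<close>, and \<open>n\<close> is
  positive. A path has at most four entries, so the last address used is at most
  \<open>base + n + 3\<close>; thus no addition wraps around.\<close>

lemma memory_fits: "base + n + 5 < 2 ^ w"
  using sum_deg_le word_length n_pos by (simp add: offset_def)

lemma input_mem_0: "input_mem 0 = n"
  by (simp add: initial_state_def encode_graph_def)

lemma length_encode_graph: "length (encode_graph n adj) = base"
  by (simp add: encode_graph_def offset_def length_concat comp_def
      interv_sum_list_conv_sum_set_nat atLeast0LessThan)

lemma input_mem_offset: "v \<le> n \<Longrightarrow> input_mem (Suc v) = offset v"
  using n_less_base
  by (simp add: initial_state_def length_encode_graph)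
     (auto simp: encode_graph_def nth_append offset_def simp del: upt_Suc)

lemma input_mem_adj:
  assumes "v < n" "j < deg v"
  shows "input_mem (offset v + j) = adj v ! j"
proof -
  have "offset v + j < base" using offset_add_le_base assms by fastforce
  then have "input_mem (offset v + j) = encode_graph n adj ! (offset v + j)"
    by (simp add: initial_state_def length_encode_graph)
  also have "\<dots> = concat (map adj [0..<n]) ! ((\<Sum>u<v. deg u) + j)"
    by (simp add: encode_graph_def offset_def nth_append del: upt_Suc)
  finally show ?thesis using nth_concat_map_upt assms by metis
qed

section \<open>Common invariant and vertex loops\<close>

text \<open>Invariant of all phases after the header: the constant registers are set and the input
  cells intact. Writes from \<open>base\<close> on preserve it.\<close>

definition env :: "state \<Rightarrow> bool" where
  "env s \<longleftrightarrow> regs s rOne = 1 \<and> regs s rN = n \<and> regs s rBase = base \<and> (\<forall>a<base. mem s a = input_mem a)"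

lemma env_set_reg [simp]: "r \<notin> {rOne, rN, rBase} \<Longrightarrow> env (set_reg r x s) = env s"
  by (simp add: env_def)

lemma env_mem_update [simp]: "env s \<Longrightarrow> env (s\<lparr>mem := m\<rparr>) \<longleftrightarrow> (\<forall>a<base. m a = mem s a)"
  by (simp add: env_def)

lemma env_regs [simp]: "env s \<Longrightarrow> regs s rOne = 1" "env s \<Longrightarrow> regs s rN = n" "env s \<Longrightarrow> regs s rBase = base"
  by (simp_all add: env_def)

lemma env_mem: "env s \<Longrightarrow> a < base \<Longrightarrow> mem s a = input_mem a"
  by (simp add: env_def del: env_regs)

lemma word_mod [simp]: "a \<le> base + n + 5 \<Longrightarrow> a mod 2 ^ w = a"
  using memory_fits by simp

lemma word_length_pos [simp]: "0 < w"
  using memory_fits by (cases w) auto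

lemma small_mod [simp]: "1 mod 2 ^ w = (1 :: nat)" "Suc 0 mod 2 ^ w = (1 :: nat)" "4 mod 2 ^ w = (4 :: nat)"
  using word_mod[of 1] word_mod[of 4] by (simp_all del: word_mod)

lemma runs_load_bounds [simp]:
  assumes "env s" "regs s rCur < n"
  shows "runs w load_bounds s Q \<longleftrightarrow>
    Q 4 (set_reg rHi (offset (regs s rCur) + deg (regs s rCur)) (set_reg rPtr (regs s rCur + 2)
      (set_reg rLo (offset (regs s rCur)) (set_reg rPtr (regs s rCur + 1) s))))"
proof -
  let ?v = "regs s rCur"
  have "mem s (Suc ?v) = offset ?v" "mem s (Suc (Suc ?v)) = offset ?v + deg ?v"
    using assms env_mem[OF assms(1)] input_mem_offset[of ?v] input_mem_offset[of "Suc ?v"] n_less_base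
    by (simp_all add: offset_Suc)
  moreover have "?v + 2 \<le> base + n + 5" using assms by simp
  moreover have four: "Suc (Suc (Suc (Suc 0))) = 4" by simp
  ultimately show ?thesis
    using assms by (simp add: load_bounds_def four)
qed

text \<open>Assumption \<open>inv\<close> keeps the invariant independent of the counter, which the
  loop itself changes. Each round adds 2 for test and increment; initialisation and the failing test
  add the last 2.\<close>

lemma runs_for_vertices:
  assumes step: "\<And>i s. i < n \<Longrightarrow> env s \<Longrightarrow> regs s rCur = i \<Longrightarrow> I i s \<Longrightarrow>
      runs w p s (\<lambda>t s'. t \<le> c i \<and> env s' \<and> regs s' rCur = i \<and> I (Suc i) s')"
    and inv: "\<And>i x s. I i (set_reg rCur x s) = I i s"
    and init: "env s" "I 0 s"
  shows "runs w (for_vertices p) s (\<lambda>t s'. t \<le> (\<Sum>i<n. c i + 2) + 2 \<and> env s' \<and> I n s')"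
proof -
  let ?J = "\<lambda>i s. env s \<and> regs s rCur = i \<and> I i s"
  have "runs w (WHILE (LESS rCur rN) (p;; INSTR (ADD rCur rCur rOne))) (set_reg rCur 0 s)
      (\<lambda>t s'. t \<le> (\<Sum>i<n. Suc (c i + 1)) + 1 \<and> ?J n s')"
  proof (rule runs_WHILE[where I = ?J and c = "\<lambda>i. c i + 1"])
    fix i s assume "i < n" "?J i s"
    then show "holds (LESS rCur rN) s \<and>
        runs w (p;; INSTR (ADD rCur rCur rOne)) s (\<lambda>t s'. t \<le> c i + 1 \<and> ?J (Suc i) s')"
      using step[of i s] by (auto elim!: runs_mono simp: inv)
  qed (use init inv in auto)
  then show ?thesis
    unfolding for_vertices_def by (auto elim!: runs_mono)
qed

lemma runs_load_header:
  "runs w load_header (initial_state (encode_graph n adj))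
     (\<lambda>t s. t = 4 \<and> env s \<and> mem s = input_mem)"
proof -
  have "input_mem (n + 1) = base" using input_mem_offset[of n] by simp
  then show ?thesis
    using input_mem_0 by (simp add: load_header_def env_def del: env_regs) (simp add: initial_state_def)
qed

lemma runs_find_min_degree:
  assumes "env s" "mem s = input_mem"
  shows "runs w find_min_degree s (\<lambda>t s'. t \<le> 11 * n + 3 \<and> env s' \<and> mem s' = input_mem \<and>
    regs s' rX < n \<and> (\<forall>v<n. deg (regs s' rX) \<le> deg v))"
proof -
  \<comment> \<open>Before the first vertex \<open>rX\<close> carries no information, hence the
    separate case \<open>i = 0\<close>.\<close>
  define I where "I = (\<lambda>i (s :: state). mem s = input_mem \<and>
    (if i = 0 then regs s rMin = n
     else regs s rX < i \<and> regs s rMin = deg (regs s rX) \<and> (\<forall>v<i. regs s rMin \<le> deg v)))"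
  have I_Suc: "I (Suc i) s \<longleftrightarrow> mem s = input_mem \<and> regs s rX < Suc i \<and> regs s rMin = deg (regs s rX) \<and>
      (\<forall>v<Suc i. regs s rMin \<le> deg v)" for i s
    by (simp add: I_def)
  let ?body = "load_bounds;; INSTR (SUB rTmp rHi rLo);;
       IF (LESS rTmp rMin) (INSTR (COPY rX rCur);; INSTR (COPY rMin rTmp)) skip"
  have "runs w (for_vertices ?body) (set_reg rMin n s)
      (\<lambda>t s'. t \<le> (\<Sum>i<n. 8 + 2) + 2 \<and> env s' \<and> I n s')"
  proof (rule runs_for_vertices[where I = I and c = "\<lambda>_. 8"])
    fix i s assume "i < n" "env s" "regs s rCur = i" "I i s"
    then show "runs w ?body s (\<lambda>t s'. t \<le> 8 \<and> env s' \<and> regs s' rCur = i \<and> I (Suc i) s')"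
      using deg_less[of i]
      by (cases "i = 0") (auto simp: I_Suc less_Suc_eq I_def)
  qed (use assms in \<open>auto simp: I_def\<close>)
  then show ?thesis
    using assms n_pos unfolding find_min_degree_def
    by (auto elim!: runs_mono simp: I_def)
qed

section \<open>Scanning an adjacency list\<close>

text \<open>The clause on \<open>rNbr\<close> depends on the flag because without a hit that
  register keeps a stale value.\<close>

definition scan_post :: "state \<Rightarrow> state \<Rightarrow> bool" where
  "scan_post s s' \<longleftrightarrow> mem s' = mem s \<and> (\<forall>r. r \<notin> scratch \<longrightarrow> regs s' r = regs s r) \<and>
     regs s' rFound = of_bool (\<exists>u\<in>set (adj (regs s rCur)). mem s (base + u) = regs s rLev) \<and>
     (regs s' rFound = 1 \<longrightarrow> regs s' rNbr \<in> set (adj (regs s rCur)) \<and> mem s (base + regs s' rNbr) = regs s rLev)"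

lemma runs_scan:
  assumes "env s" "regs s rCur < n"
  shows "runs w scan s (\<lambda>t s'. t \<le> 8 * deg (regs s rCur) + 6 \<and> scan_post s s')"
proof -
  define v where "v = regs s rCur"
  have v: "v < n" using assms by (simp add: v_def)
  define hit where "hit = (\<lambda>u. mem s (base + u) = regs s rLev)"
  define I where "I = (\<lambda>j (s' :: state). mem s' = mem s \<and> (\<forall>r. r \<notin> scratch \<longrightarrow> regs s' r = regs s r) \<and>
     regs s' rLo = offset v + j \<and> regs s' rHi = offset v + deg v \<and>
     regs s' rFound = of_bool (\<exists>u\<in>set (take j (adj v)). hit u) \<and>
     (regs s' rFound = 1 \<longrightarrow> regs s' rNbr \<in> set (adj v) \<and> hit (regs s' rNbr)))"
  let ?body = "INSTR (LOAD rPtr rLo);; INSTR (ADD rTmp rBase rPtr);; INSTR (LOAD rTmp rTmp);;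
        IF (EQUAL rTmp rLev) (INSTR (COPY rNbr rPtr);; INSTR (SET rFound 1)) skip;;
        INSTR (ADD rLo rLo rOne)"
  \<comment> \<open>The state at loop entry, in the shape produced by
    \<open>runs_load_bounds\<close>.\<close>
  define s0 where "s0 = set_reg rHi (offset v + deg v) (set_reg rPtr (v + 2)
      (set_reg rLo (offset v) (set_reg rPtr (v + 1) (set_reg rFound 0 s))))"
  have "runs w (WHILE (LESS rLo rHi) ?body) s0 (\<lambda>t s'. t \<le> (\<Sum>j<deg v. Suc 7) + 1 \<and> I (deg v) s')"
  proof (rule runs_WHILE[where I = I and c = "\<lambda>_. 7"])
    fix j s' assume j: "j < deg v" and I: "I j s'"
    have u: "mem s (offset v + j) = adj v ! j"
      using input_mem_adj[OF v j] env_mem[OF assms(1)] offset_add_le_base[OF v] j by simp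
    have "adj v ! j < n" using adj_nth_less v j by blast
    moreover have "offset v + j < base" using offset_add_le_base[OF v] j by simp
    moreover have "adj v ! j \<in> set (adj v)" using j by simp
    ultimately show "holds (LESS rLo rHi) s' \<and> runs w ?body s' (\<lambda>t s'. t \<le> 7 \<and> I (Suc j) s')"
      using j I u assms(1) by (auto simp: I_def hit_def take_Suc_conv_app_nth)
  qed (auto simp: I_def s0_def)
  then have "runs w (WHILE (LESS rLo rHi) ?body) s0 (\<lambda>t s'. t \<le> 8 * deg v + 1 \<and> scan_post s s')"
    by (rule runs_mono) (auto simp: I_def scan_post_def hit_def v_def)
  then show ?thesis
    using assms v unfolding scan_def
    by (auto elim!: runs_mono simp: s0_def v_def)
qed

section \<open>Computing the distance labels\<close>

text \<open>The label of \<open>v\<close> after \<open>d\<close> sweeps. The shift by one frees 0,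
  the content of blank memory, to mean unreached.\<close>

definition level :: "nat \<Rightarrow> nat \<Rightarrow> nat \<Rightarrow> nat" where
  "level x d v = (if hops v x \<le> d then Suc (hops v x) else 0)"

lemma level_eq_Suc [simp]: "level x d u = Suc d \<longleftrightarrow> hops u x = d"
  by (auto simp: level_def)

text \<open>With \<open>level_eq_Suc\<close> this makes in-place updates harmless: old and new
  labels equal \<open>Suc d\<close> for the same vertices.\<close>

lemma level_Suc_eq_Suc [simp]: "level x (Suc d) u = Suc d \<longleftrightarrow> hops u x = d"
  by (auto simp: level_def)

text \<open>The breadth-first criterion: for a vertex farther than \<open>d\<close>, a neighbour in
  layer \<open>d\<close> forces distance exactly \<open>Suc d\<close>.\<close>

lemma hops_eq_Suc_iff:
  assumes "v < n" "x < n" "d < hops v x"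
  shows "hops v x = Suc d \<longleftrightarrow> (\<exists>u\<in>set (adj v). hops u x = d)"
proof
  assume "hops v x = Suc d"
  then obtain u where "(v, u) \<in> parcs G" "hops u x = d"
    using hops_Suc_obtain assms verts by blast
  then show "\<exists>u\<in>set (adj v). hops u x = d"
    using set_adj assms by auto
next
  assume "\<exists>u\<in>set (adj v). hops u x = d"
  then obtain u where "(v, u) \<in> parcs G" "hops u x = d"
    using set_adj assms by auto
  then have "hops v x \<le> Suc d"
    using hops_le_Suc[of v u x] assms verts by auto
  then show "hops v x = Suc d" using assms by simp
qed

lemma runs_sweep:
  assumes "env s" "x < n" "regs s rLev = Suc d" "d < 3" "regs s rFour = 4"
    and levels: "\<forall>v<n. mem s (base + v) = level x d v"
  shows "runs w sweep s (\<lambda>t s'. t \<le> 16 * n + 16 * n_edges G + 2 \<and> env s' \<and>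
    (\<forall>v<n. mem s' (base + v) = level x (Suc d) v) \<and> regs s' rLev = Suc d \<and> regs s' rFour = 4)"
proof -
  \<comment> \<open>Mid-sweep, the cells of vertices below \<open>i\<close> hold new labels and the
    rest still hold old ones.\<close>
  define I where "I = (\<lambda>i (s :: state). regs s rLev = Suc d \<and> regs s rFour = 4 \<and>
    (\<forall>v<i. mem s (base + v) = level x (Suc d) v) \<and>
    (\<forall>v<n. i \<le> v \<longrightarrow> mem s (base + v) = level x d v))"
  let ?write = "INSTR (ADD rPtr rBase rCur);; INSTR (ADD rTmp rLev rOne);; INSTR (STORE rPtr rTmp)"
  let ?body = "INSTR (ADD rPtr rBase rCur);; INSTR (LOAD rTmp rPtr);;
     IF (LESS rTmp rOne) (scan;; IF (EQUAL rFound rOne) ?write skip) skip"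
  have "runs w (for_vertices ?body) s (\<lambda>t s'. t \<le> (\<Sum>i<n. (8 * deg i + 13) + 2) + 2 \<and> env s' \<and> I n s')"
  \<comment> \<open>The 13 consists of 6 for \<open>scan\<close> beyond its per-neighbour cost, 3
    for reading and testing the label, and 4 for the test of the flag and the write.\<close>
  proof (rule runs_for_vertices[where I = I and c = "\<lambda>i. 8 * deg i + 13"])
    fix i s assume i: "i < n" and s: "env s" "regs s rCur = i" and I: "I i s"
    have mem_i: "mem s (base + i) = level x d i" using I i by (simp add: I_def)
    show "runs w ?body s (\<lambda>t s'. t \<le> 8 * deg i + 13 \<and> env s' \<and> regs s' rCur = i \<and> I (Suc i) s')"
    proof (cases "hops i x \<le> d")
      case True
      then have "I (Suc i) s" using I i by (auto simp: I_def less_Suc_eq level_def)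
      then show ?thesis
        using True s i mem_i by (simp add: level_def I_def)
    next
      case False
      define s1 where "s1 = set_reg rTmp 0 (set_reg rPtr (base + i) s)"
      have s1: "env s1" "regs s1 rCur = i" using s by (simp_all add: s1_def)
      have hit: "mem s (base + u) = Suc d \<longleftrightarrow> hops u x = d" if "u \<in> set (adj i)" for u
        using adj_less[OF i that] I by (cases "u < i") (auto simp: I_def)
      have "runs w scan s1 (\<lambda>t s'. t \<le> 8 * deg i + 6 \<and> scan_post s1 s')"
        using runs_scan[of s1] s1 i by simp
      then have "runs w scan s1 (\<lambda>t s'. t \<le> 8 * deg i + 6 \<and> mem s' = mem s \<and>
          env s' \<and> regs s' rCur = i \<and> regs s' rLev = Suc d \<and> regs s' rFour = 4 \<and>
          regs s' rFound = of_bool (hops i x = Suc d))"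
      proof (rule runs_mono, elim conjE, intro conjI)
        fix t s' assume t: "t \<le> 8 * deg i + 6" and post: "scan_post s1 s'"
        show "t \<le> 8 * deg i + 6" by fact
        show mem: "mem s' = mem s" using post by (simp add: scan_post_def s1_def)
        have regs: "regs s' r = regs s r" if "r \<notin> scratch" for r
          using post that unfolding scan_post_def s1_def by simp
        show "env s'" using s(1) mem regs unfolding env_def by simp
        show "regs s' rCur = i" "regs s' rLev = Suc d" "regs s' rFour = 4"
          using I s by (simp_all add: regs I_def)
        have "(\<exists>u\<in>set (adj i). mem s (base + u) = Suc d) \<longleftrightarrow> hops i x = Suc d"
          using hit hops_eq_Suc_iff[of i x d] i assms(2) False by auto
        then show "regs s' rFound = of_bool (hops i x = Suc d)"
          using post I s unfolding scan_post_def by (simp add: s1_def I_def)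
      qed
      then have "runs w (scan;; IF (EQUAL rFound rOne) ?write skip) s1
          (\<lambda>t s'. t \<le> 8 * deg i + 10 \<and> env s' \<and> regs s' rCur = i \<and> I (Suc i) s')"
        unfolding runs_SEQ
      proof (rule runs_mono, elim conjE)
        fix t s'
        assume s': "t \<le> 8 * deg i + 6" "mem s' = mem s" "env s'" "regs s' rCur = i"
          "regs s' rLev = Suc d" "regs s' rFour = 4" "regs s' rFound = of_bool (hops i x = Suc d)"
        show "runs w (IF (EQUAL rFound rOne) ?write skip) s' (\<lambda>t' s''. t + t' \<le> 8 * deg i + 10 \<and>
            env s'' \<and> regs s'' rCur = i \<and> I (Suc i) s'')"
        proof (cases "hops i x = Suc d")
          case True
          then have "level x (Suc d) i = Suc (Suc d)" by (simp add: level_def)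
          then show ?thesis
            using True s' i I \<open>d < 3\<close> by (auto simp: I_def less_Suc_eq simp del: level_eq_Suc)
        next
          case False
          then have "I (Suc i) s'"
            using I i s' \<open>\<not> hops i x \<le> d\<close> by (auto simp: I_def level_def less_Suc_eq)
          then show ?thesis
            using False s' by simp
        qed
      qed
      moreover have "mem s (base + i) = 0" using mem_i False by (simp add: level_def)
      ultimately show ?thesis
        using s i by (auto elim!: runs_mono simp: s1_def)
    qed
  qed (use assms in \<open>auto simp: I_def\<close>)
  moreover have "(\<Sum>i<n. (8 * deg i + 13) + 2) = 8 * (\<Sum>i<n. deg i) + 15 * n"
    by (simp add: sum.distrib sum_distrib_left)
  ultimately show ?thesis
    unfolding sweep_def using sum_deg_le by (auto elim!: runs_mono simp: I_def)
qed

lemma runs_compute_levels: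
  assumes "env s" "mem s = input_mem" "regs s rX = x" "x < n"
  shows "runs w compute_levels s (\<lambda>t s'. t \<le> 48 * n + 48 * n_edges G + 17 \<and> env s' \<and>
    (\<forall>v<n. mem s' (base + v) = Suc (hops v x)))"
proof -
  define I where "I = (\<lambda>d (s :: state). env s \<and> regs s rLev = Suc d \<and> regs s rFour = 4 \<and>
    (\<forall>v<n. mem s (base + v) = level x d v))"
  define s0 where "s0 = set_reg rLev 1 (set_reg rFour 4
    ((set_reg rPtr (base + x) s)\<lparr>mem := (mem s)(base + x := 1)\<rparr>))"
  \<comment> \<open>Cells from \<open>base\<close> on lie beyond the encoded input.\<close>
  have blank: "mem s (base + v) = 0" for v
    using assms by (simp add: initial_state_def length_encode_graph)
  have "env s0"
    using assms by (simp add: s0_def)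
  then have "I 0 s0"
    using assms blank verts by (auto simp: I_def s0_def level_def hops_eq_0)
  have "runs w (WHILE (LESS rLev rFour) (sweep;; INSTR (ADD rLev rLev rOne))) s0
      (\<lambda>t s'. t \<le> (\<Sum>d<(3::nat). Suc (16 * n + 16 * n_edges G + 3)) + 1 \<and> I 3 s')"
  proof (rule runs_WHILE[where I = I and c = "\<lambda>_. 16 * n + 16 * n_edges G + 3"])
    fix d s assume "d < 3" "I d s"
    then show "holds (LESS rLev rFour) s \<and> runs w (sweep;; INSTR (ADD rLev rLev rOne)) s
        (\<lambda>t s'. t \<le> 16 * n + 16 * n_edges G + 3 \<and> I (Suc d) s')"
      using runs_sweep[of s x d] \<open>x < n\<close> by (auto elim!: runs_mono simp: I_def)
  qed (use \<open>I 0 s0\<close> in \<open>auto simp: I_def\<close>)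
  \<comment> \<open>All distances are at most 3, so after three sweeps \<open>level x 3 v\<close> is
    \<open>Suc (hops v x)\<close> everywhere.\<close>
  then show ?thesis
    using assms hops_le_3 verts unfolding compute_levels_def
    by (auto elim!: runs_mono simp: I_def s0_def level_def)
qed

section \<open>Farthest vertex and path extraction\<close>

lemma runs_find_farthest:
  assumes "env s" "\<forall>v<n. mem s (base + v) = Suc (hops v x)"
  shows "runs w find_farthest s (\<lambda>t s'. t \<le> 8 * n + 3 \<and> env s' \<and>
    (\<forall>v<n. mem s' (base + v) = Suc (hops v x)) \<and> regs s' rFar < n \<and>
    regs s' rLev = Suc (hops (regs s' rFar) x) \<and> (\<forall>v<n. hops v x \<le> hops (regs s' rFar) x))"
proof -
  define I where "I = (\<lambda>i (s :: state). (\<forall>v<n. mem s (base + v) = Suc (hops v x)) \<and>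
    (if i = 0 then regs s rLev = 0 else regs s rFar < i \<and>
     regs s rLev = Suc (hops (regs s rFar) x) \<and> (\<forall>v<i. hops v x \<le> hops (regs s rFar) x)))"
  have I_Suc: "I (Suc i) s \<longleftrightarrow> (\<forall>v<n. mem s (base + v) = Suc (hops v x)) \<and> regs s rFar < Suc i \<and>
     regs s rLev = Suc (hops (regs s rFar) x) \<and> (\<forall>v<Suc i. hops v x \<le> hops (regs s rFar) x)" for i s
    by (simp add: I_def)
  let ?body = "INSTR (ADD rPtr rBase rCur);; INSTR (LOAD rTmp rPtr);;
       IF (LESS rLev rTmp) (INSTR (COPY rFar rCur);; INSTR (COPY rLev rTmp)) skip"
  have "runs w (for_vertices ?body) (set_reg rLev 0 s)
      (\<lambda>t s'. t \<le> (\<Sum>i<n. 5 + 2) + 2 \<and> env s' \<and> I n s')"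
  proof (rule runs_for_vertices[where I = I and c = "\<lambda>_. 5"])
    fix i s assume "i < n" "env s" "regs s rCur = i" "I i s"
    then show "runs w ?body s (\<lambda>t s'. t \<le> 5 \<and> env s' \<and> regs s' rCur = i \<and> I (Suc i) s')"
      by (cases "i = 0") (auto simp: I_Suc less_Suc_eq I_def)
  qed (use assms in \<open>auto simp: I_def\<close>)
  then show ?thesis
    using n_pos unfolding find_farthest_def
    by (auto elim!: runs_mono simp: I_def)
qed

lemma runs_extract_path:
  assumes "env s" "\<forall>v<n. mem s (base + v) = Suc (hops v x)" "x < n"
    and "regs s rFar = y" "y < n" "regs s rLev = Suc (hops y x)"
  shows "runs w extract_path s (\<lambda>t s'. t \<le> 24 * n + 42 \<and> output_number s' = hops y x \<and>
    length (output_list s') = Suc (hops y x) \<and> output_list s' ! 0 = y \<and>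
    (\<forall>k\<le>hops y x. output_list s' ! k < n \<and> hops (output_list s' ! k) x + k = hops y x) \<and>
    (\<forall>k<hops y x. (output_list s' ! k, output_list s' ! Suc k) \<in> parcs G))"
proof -
  define h where "h = hops y x"
  have h: "h \<le> 3" using hops_le_3 assms verts by (simp add: h_def)
  define path_ok where "path_ok = (\<lambda>i (m :: nat \<Rightarrow> nat).
    (\<forall>v<n. m (base + v) = Suc (hops v x)) \<and> m (base + n) = y \<and>
    (\<forall>k\<le>i. m (base + n + k) < n \<and> hops (m (base + n + k)) x + k = h) \<and>
    (\<forall>k<i. (m (base + n + k), m (base + n + Suc k)) \<in> parcs G))"
  define I where "I = (\<lambda>i (s :: state). env s \<and> path_ok i (mem s) \<and>
    regs s rOut = h \<and> regs s rAddr = base + n \<and> regs s rLen = Suc i \<and> regs s rLev + i = Suc h \<and>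
    regs s rCur = mem s (base + n + i))"
  let ?append = "INSTR (COPY rCur rNbr);; INSTR (ADD rPtr rAddr rLen);; INSTR (STORE rPtr rCur);;
        INSTR (ADD rLen rLen rOne)"
  let ?body = "INSTR (SUB rLev rLev rOne);; scan;; ?append"
  define s0 where "s0 = (set_reg rCur y (set_reg rLen 1 (set_reg rAddr (base + n) (set_reg rOut h s))))
    \<lparr>mem := (mem s)(base + n := y)\<rparr>"
  have "env s0"
    using assms by (simp add: s0_def)
  then have "I 0 s0"
    using assms by (simp add: I_def s0_def h_def path_ok_def)
  have "runs w (WHILE (LESS rOne rLev) ?body) s0 (\<lambda>t s'. t \<le> (\<Sum>i<h. Suc (8 * n + 11)) + 1 \<and> I h s')"
  proof (rule runs_WHILE[where I = I and c = "\<lambda>_. 8 * n + 11"])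
    fix i s assume i: "i < h" and I: "I i s"
    define c where "c = regs s rCur"
    have c: "c < n" "hops c x + i = h" using I by (auto simp: I_def path_ok_def c_def)
    have lev: "regs s rLev = Suc (hops c x)" using I c by (simp add: I_def)
    define s1 where "s1 = set_reg rLev (hops c x) s"
    have s1: "env s1" "regs s1 rCur = c" using I by (simp_all add: s1_def c_def I_def)
    obtain d where d: "hops c x = Suc d" using c i by (cases "hops c x") auto
    have hit: "mem s (base + u) = Suc d \<longleftrightarrow> hops u x = d" if "u \<in> set (adj c)" for u
      using adj_less[OF c(1) that] I by (auto simp: I_def path_ok_def)
    \<comment> \<open>The scan cannot fail: \<open>c\<close> is not yet \<open>x\<close>, so it has
      a neighbour one step closer.\<close>
    have ex: "\<exists>u\<in>set (adj c). hops u x = d"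
      using hops_eq_Suc_iff[of c x d] c d assms(3) by simp
    have "runs w scan s1 (\<lambda>t s'. t \<le> 8 * n + 6 \<and> scan_post s1 s')"
      using runs_scan[of s1] s1 c deg_less[OF c(1)] by (auto elim!: runs_mono)
    then have "runs w scan s1 (\<lambda>t s'. t \<le> 8 * n + 6 \<and> mem s' = mem s \<and>
          (\<forall>r. r \<notin> insert rLev scratch \<longrightarrow> regs s' r = regs s r) \<and> env s' \<and> regs s' rLev = hops c x \<and>
          regs s' rNbr < n \<and> (c, regs s' rNbr) \<in> parcs G \<and> hops (regs s' rNbr) x = d)"
    proof (rule runs_mono, elim conjE, intro conjI)
      fix t s' assume t: "t \<le> 8 * n + 6" and post: "scan_post s1 s'"
      show "t \<le> 8 * n + 6" by fact
      show mem: "mem s' = mem s" using post by (simp add: scan_post_def s1_def)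
      have regs: "regs s' r = regs s1 r" if "r \<notin> scratch" for r
        using post that unfolding scan_post_def by simp
      then show "\<forall>r. r \<notin> insert rLev scratch \<longrightarrow> regs s' r = regs s r" by (simp add: s1_def)
      show "env s'" using s1(1) mem regs unfolding env_def by (simp add: s1_def)
      show "regs s' rLev = hops c x" using regs by (simp add: s1_def)
      have "\<exists>u\<in>set (adj c). mem s (base + u) = Suc d" using ex hit by blast
      then have "regs s' rNbr \<in> set (adj c)" "mem s (base + regs s' rNbr) = Suc d"
        using post d s1(2) unfolding scan_post_def by (auto simp: s1_def)
      then show "regs s' rNbr < n" "(c, regs s' rNbr) \<in> parcs G" "hops (regs s' rNbr) x = d"
        using adj_less c set_adj hit by auto
    qed
    then have "runs w (scan;; ?append) s1 (\<lambda>t s'. t \<le> 8 * n + 10 \<and> I (Suc i) s')"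
      unfolding runs_SEQ[of _ scan]
    proof (rule runs_mono, elim conjE)
      fix t s'
      assume s': "t \<le> 8 * n + 6" "mem s' = mem s" "env s'" "regs s' rLev = hops c x"
        "regs s' rNbr < n" "(c, regs s' rNbr) \<in> parcs G" "hops (regs s' rNbr) x = d"
        and same: "\<forall>r. r \<notin> insert rLev scratch \<longrightarrow> regs s' r = regs s r"
      define u where "u = regs s' rNbr"
      define m where "m = (mem s)(base + n + Suc i := u)"
      \<comment> \<open>The new entry lies just past the stored prefix, so labels and earlier
        entries survive.\<close>
      have old: "m a = mem s a" if "a \<le> base + n + i" for a
        using that by (simp add: m_def)
      have new: "m (base + n + Suc i) = u" by (simp add: m_def)
      have u: "u < n" "hops u x + Suc i = h" "(mem s (base + n + i), u) \<in> parcs G"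
        using s' c d I by (simp_all add: u_def c_def I_def)
      have "path_ok i (mem s)" using I by (simp add: I_def)
      then have "path_ok (Suc i) m"
        using u new by (auto simp: path_ok_def old less_Suc_eq le_Suc_eq)
      moreover have "regs s' rAddr = base + n" "regs s' rLen = Suc i" "regs s' rOut = h"
        using same I by (simp_all add: I_def)
      ultimately show "runs w ?append s' (\<lambda>t' s''. t + t' \<le> 8 * n + 10 \<and> I (Suc i) s'')"
        using s' c i h by (simp add: I_def m_def u_def)
    qed
    moreover have "holds (LESS rOne rLev) s" using lev d I by (simp add: I_def)
    ultimately show "holds (LESS rOne rLev) s \<and> runs w ?body s (\<lambda>t s'. t \<le> 8 * n + 11 \<and> I (Suc i) s')"
      using I lev by (auto elim!: runs_mono simp: s1_def I_def)
  qed (use \<open>I 0 s0\<close> in \<open>auto simp: I_def\<close>)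
  \<comment> \<open>At most three rounds, each scanning fewer than \<open>n\<close> neighbours, keep
    the extraction linear.\<close>
  moreover have "(\<Sum>i<h. Suc (8 * n + 11)) \<le> 3 * (8 * n + 12)"
    using mult_le_mono1[OF h, of "12 + 8 * n"] by simp
  ultimately have "runs w (WHILE (LESS rOne rLev) ?body) s0 (\<lambda>t s'. t \<le> 24 * n + 37 \<and> I h s')"
    by (auto elim!: runs_mono)
  then show ?thesis
    using assms unfolding extract_path_def
    by (auto elim!: runs_mono simp: s0_def I_def path_ok_def h_def output_number_def output_list_def
      simp del: upt_Suc)
qed

section \<open>Assembling the phases\<close>

text \<open>Minimum degree and minimum closed neighbourhood coincide because the cardinalities
  differ by exactly one.\<close>

lemma diametral_path_from_min_degree:
  assumes "x < n" "\<forall>v<n. deg x \<le> deg v"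
    and "y < n" "\<forall>v<n. hops v x \<le> hops y x"
    and "length p = Suc (hops y x)" "p ! 0 = y"
    and "\<forall>k\<le>hops y x. p ! k < n \<and> hops (p ! k) x + k = hops y x"
    and "\<forall>k<hops y x. (p ! k, p ! Suc k) \<in> parcs G"
  shows "diam (with_proj G) = ereal (real (hops y x))" "diametral_path (with_proj G) p"
proof -
  show diam: "diam (with_proj G) = ereal (real (hops y x))"
    using assms verts card_closed_neighbourhood
    by (intro diam_eq_eccentricity_of_min_degree) auto
  have "hd p = y" using assms(5,6) by (cases p) auto
  then show "diametral_path (with_proj G) p"
    using assms verts diam by (intro diametral_pathI[of p x]) auto
qed

text \<open>The phase bounds add up to \<open>91 * n + 48 * n_edges G + 69\<close>; positivity of
  \<open>n\<close> absorbs the constant.\<close>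

lemma runs_diameter_prog:
  "runs w diameter_prog (initial_state (encode_graph n adj))
     (\<lambda>t s. t \<le> 200 * (n + n_edges G) \<and> ereal (real (output_number s)) = diam (with_proj G) \<and>
        diametral_path (with_proj G) (output_list s))"
  unfolding diameter_prog_def runs_SEQ
proof (rule runs_mono[OF runs_load_header], elim conjE)
  fix t1 :: nat and s1 assume s1: "t1 = 4" "env s1" "mem s1 = input_mem"
  show "runs w find_min_degree s1 (\<lambda>t2 s2. runs w compute_levels s2 (\<lambda>t3 s3.
      runs w find_farthest s3 (\<lambda>t4 s4. runs w extract_path s4 (\<lambda>t5 s.
        t1 + (t2 + (t3 + (t4 + t5))) \<le> 200 * (n + n_edges G) \<and>
        ereal (real (output_number s)) = diam (with_proj G) \<and>
        diametral_path (with_proj G) (output_list s)))))"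
  proof (rule runs_mono[OF runs_find_min_degree[OF s1(2,3)]], elim conjE)
    fix t2 :: nat and s2 assume s2: "t2 \<le> 11 * n + 3" "env s2" "mem s2 = input_mem" "regs s2 rX < n"
      "\<forall>v<n. deg (regs s2 rX) \<le> deg v"
    define x where "x = regs s2 rX"
    have x: "x < n" "\<forall>v<n. deg x \<le> deg v" using s2 by (simp_all add: x_def)
    show "runs w compute_levels s2 (\<lambda>t3 s3.
      runs w find_farthest s3 (\<lambda>t4 s4. runs w extract_path s4 (\<lambda>t5 s.
        t1 + (t2 + (t3 + (t4 + t5))) \<le> 200 * (n + n_edges G) \<and>
        ereal (real (output_number s)) = diam (with_proj G) \<and>
        diametral_path (with_proj G) (output_list s))))"
    proof (rule runs_mono[OF runs_compute_levels[OF s2(2,3) x_def[symmetric] x(1)]], elim conjE)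
      fix t3 :: nat and s3 assume s3: "t3 \<le> 48 * n + 48 * n_edges G + 17" "env s3"
        "\<forall>v<n. mem s3 (base + v) = Suc (hops v x)"
      show "runs w find_farthest s3 (\<lambda>t4 s4. runs w extract_path s4 (\<lambda>t5 s.
        t1 + (t2 + (t3 + (t4 + t5))) \<le> 200 * (n + n_edges G) \<and>
        ereal (real (output_number s)) = diam (with_proj G) \<and>
        diametral_path (with_proj G) (output_list s)))"
      proof (rule runs_mono[OF runs_find_farthest[OF s3(2,3)]], elim conjE)
        fix t4 :: nat and s4 assume s4: "t4 \<le> 8 * n + 3" "env s4"
          "\<forall>v<n. mem s4 (base + v) = Suc (hops v x)" "regs s4 rFar < n"
          "regs s4 rLev = Suc (hops (regs s4 rFar) x)" "\<forall>v<n. hops v x \<le> hops (regs s4 rFar) x"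
        show "runs w extract_path s4 (\<lambda>t5 s.
          t1 + (t2 + (t3 + (t4 + t5))) \<le> 200 * (n + n_edges G) \<and>
          ereal (real (output_number s)) = diam (with_proj G) \<and>
          diametral_path (with_proj G) (output_list s))"
          using s1(1) s2(1) s3(1) s4(1) n_pos
            diametral_path_from_min_degree[OF x s4(4,6)]
          by (intro runs_mono[OF runs_extract_path[OF s4(2,3) x(1) refl s4(4,5)]]) auto
      qed
    qed
  qed
qed

end

theorem theorem12:
  shows "\<exists>(P :: prog) (k :: nat) (C :: nat).
    \<forall>(G :: nat pair_pre_digraph) (n :: nat) (m :: nat) (adj :: nat \<Rightarrow> nat list) (w :: nat).
      pair_graph G \<and> pverts G = {..<n} \<and> n_edges G = m \<and>
      Digraph_Component.connected (with_proj G) \<and>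
      H_free (with_proj P3_plus_P1) (with_proj G) \<and>
      adjacency_lists G adj \<and> k * (n + m) \<le> 2 ^ w \<longrightarrow>
      (\<exists>t s. exec w P (initial_state (encode_graph n adj)) t s \<and>
             t \<le> C * (n + m) \<and>
             ereal (real (output_number s)) = diam (with_proj G) \<and>
             diametral_path (with_proj G) (output_list s))"
\<comment> \<open>The factor 20 makes all addresses fit into words (\<open>memory_fits\<close>), and
  200 covers the total of the phase bounds.\<close>
proof (rule exI[of _ diameter_prog], rule exI[of _ 20], rule exI[of _ 200], intro allI impI, elim conjE)
  fix G :: "nat pair_pre_digraph" and n m w :: nat and adj :: "nat \<Rightarrow> nat list"
  assume "pair_graph G" "pverts G = {..<n}" "n_edges G = m"
    "Digraph_Component.connected (with_proj G)"
    "H_free (with_proj P3_plus_P1) (with_proj G)" "adjacency_lists G adj" "20 * (n + m) \<le> 2 ^ w"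
  then interpret ram_input G n adj w
    by (auto simp: ram_input_def ram_input_axioms_def connected_P3_plus_P1_free_graph_def
        connected_P3_plus_P1_free_graph_axioms_def connected_pair_graph_def
        connected_pair_graph_axioms_def)
  show "\<exists>t s. exec w diameter_prog (initial_state (encode_graph n adj)) t s \<and>
      t \<le> 200 * (n + m) \<and> ereal (real (output_number s)) = diam (with_proj G) \<and>
      diametral_path (with_proj G) (output_list s)"
    using runs_diameter_prog \<open>n_edges G = m\<close> by (simp add: runs_def)
qed

end
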